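(* Let $F$ be strictly convex, let $\Theta_j$ be strictly convex for every $j\in J$, and let $S$ be convex. Suppose that for every $x\in S$ the projection sets $\mathcal{P}_F(x;\Omega_i)$ and $\Pi_F(x;\Theta_j)$ are nonempty for all $i\in I$ and $j\in J$. Then the optimization problem $$\text{minimize } \mathcal{G}(x)\ \text{ subject to } x\in S$$ has at most one optimal solution if and only if one of the following conditions is satisfied: (1) The index set $I$ is empty and $\bigcap_{j\in J}[\Theta_j\cap S]$ contains at most one point. (2) The index set $I$ is nonempty.
   Context: Standing setting: $X$ is a (real) normed space; $F\subset X$ is a closed, bounded, convex set containing $0$ as an interior point; $I$ and $J$ are finite index sets with $I\cup J\neq\emptyset$; $\Omega_i\subset X$ is nonempty, closed and bounded for every $i\in I$; $\Theta_j\subset X$ is nonempty and closed for every $j\in J$; $S\subset X$ is nonempty and closed. A set $C\subset X$ is strictly convex if for all $x,y\in C$ with $x\neq y$ and all $t\in(0,1)$ one has $tx+(1-t)y\in\operatorname{int}C$. $\rho_F(x):=\inf\{t\ge 0: x\in tF\}$ is the Minkowski function of $F$. For a nonempty closed bounded set $Q\subset X$, $C_F(x;Q):=\inf\{t\ge 0: Q\subset x+tF\}=\sup\{\rho_F(q-x): q\in Q\}$. For a nonempty closed set $Q\subset X$, $T_F(x;Q):=\inf\{t\ge 0: (x+tF)\cap Q\neq\emptyset\}=\inf\{\rho_F(q-x): q\in Q\}$. Farthest projection: $\mathcal{P}_F(x;\Omega):=\{\omega\in\Omega: \rho_F(\omega-x)=C_F(x;\Omega)\}$. Projection: $\Pi_F(x;\Theta):=\{u\in\Theta:\rho_F(u-x)=T_F(x;\Theta)\}$.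 $\mathcal{G}(x):=\max\{C_F(x;\Omega_i),\,T_F(x;\Theta_j): i\in I,\ j\in J\}$. *)

theory Defs
  imports "HOL-Analysis.Analysis"
begin

definition strictly_convex :: "'a::real_normed_vector set \<Rightarrow> bool" where
  "strictly_convex C \<longleftrightarrow>
     (\<forall>x\<in>C. \<forall>y\<in>C. x \<noteq> y \<longrightarrow>
        (\<forall>t\<in>{0<..<1}. t *\<^sub>R x + (1 - t) *\<^sub>R y \<in> interior C))"

text \<open>The infima below are taken in the reals. If \<open>F\<close> is bounded with \<open>0\<close> in its interior
  and \<open>Q\<close> is nonempty (and bounded, for \<open>max_time\<close>), then the sets involved are nonempty
  and bounded below, so that they are genuine infima.\<close>

definition minkowski :: "'a::real_normed_vector set \<Rightarrow> 'a \<Rightarrow> real" where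
  "minkowski F x = Inf {t. 0 \<le> t \<and> x \<in> (\<lambda>f. t *\<^sub>R f) ` F}"

text \<open>\<open>max_time F x Q\<close> is $C_F(x;Q)$ and \<open>min_time F x Q\<close> is $T_F(x;Q)$.\<close>

definition max_time :: "'a::real_normed_vector set \<Rightarrow> 'a \<Rightarrow> 'a set \<Rightarrow> real" where
  "max_time F x Q = Inf {t. 0 \<le> t \<and> Q \<subseteq> (\<lambda>f. x + t *\<^sub>R f) ` F}"

definition min_time :: "'a::real_normed_vector set \<Rightarrow> 'a \<Rightarrow> 'a set \<Rightarrow> real" where
  "min_time F x Q = Inf {t. 0 \<le> t \<and> (\<lambda>f. x + t *\<^sub>R f) ` F \<inter> Q \<noteq> {}}"

definition farthest_proj :: "'a::real_normed_vector set \<Rightarrow> 'a \<Rightarrow> 'a set \<Rightarrow> 'a set" where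
  "farthest_proj F x \<Omega> = {\<omega> \<in> \<Omega>. minkowski F (\<omega> - x) = max_time F x \<Omega>}"

definition nearest_proj :: "'a::real_normed_vector set \<Rightarrow> 'a \<Rightarrow> 'a set \<Rightarrow> 'a set" where
  "nearest_proj F x \<Theta> = {u \<in> \<Theta>. minkowski F (u - x) = min_time F x \<Theta>}"

definition cost ::
  "'a::real_normed_vector set \<Rightarrow> 'i set \<Rightarrow> ('i \<Rightarrow> 'a set) \<Rightarrow> 'j set \<Rightarrow> ('j \<Rightarrow> 'a set) \<Rightarrow> 'a \<Rightarrow> real"
where
  "cost F I \<Omega> J \<Theta> x =
     Max ((\<lambda>i. max_time F x (\<Omega> i)) ` I \<union> (\<lambda>j. min_time F x (\<Theta> j)) ` J)"

end

theory Submission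
  imports Defs
begin

text \<open>
  Uniqueness is a midpoint argument. Let \<open>x \<noteq> y\<close> be two points of \<open>S\<close> at which the cost is at
  most \<open>r > 0\<close>, and let \<open>z\<close> be their midpoint. Then every term of the maximum defining the cost
  is strictly smaller than \<open>r\<close> at \<open>z\<close>, so \<open>x\<close> and \<open>y\<close> cannot both be optimal with value \<open>r\<close>.

  For a target \<open>\<Omega>\<^sub>i\<close>, a point \<open>\<omega>\<close> farthest from \<open>z\<close> has the distinct displacements
  \<open>\<omega> - x\<close> and \<open>\<omega> - y\<close> in \<open>r F\<close>, and strict convexity of \<open>F\<close> puts their mean \<open>\<omega> - z\<close>
  into the interior of \<open>r F\<close> (\<open>max_time_midpoint_less\<close>).
  For a target \<open>\<Theta>\<^sub>j\<close>, let \<open>u\<close> and \<open>v\<close> be nearest points to \<open>x\<close> and \<open>y\<close>. If the displacements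
  \<open>u - x\<close> and \<open>v - y\<close> differ, strict convexity of \<open>F\<close> applies again. If they coincide, then
  \<open>u \<noteq> v\<close>, the midpoint of \<open>u\<close> and \<open>v\<close> is interior to \<open>\<Theta>\<^sub>j\<close>, and one can move from it towards
  \<open>z\<close> without leaving \<open>\<Theta>\<^sub>j\<close>: the displacement is scaled by a factor below \<open>1\<close>, and its size
  drops below \<open>r\<close> (\<open>min_time_midpoint_less\<close>).

  What remains is the optimal value \<open>0\<close>. The Minkowski function vanishes only at the origin, so
  a point has cost \<open>0\<close> iff it is the only element of every \<open>\<Omega>\<^sub>i\<close> and lies in every \<open>\<Theta>\<^sub>j\<close>. Two
  such points are impossible when some \<open>\<Omega>\<^sub>i\<close> exists; otherwise the points of cost \<open>0\<close> in \<open>S\<close>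
  are exactly those of the intersection of the sets \<open>\<Theta>\<^sub>j \<inter> S\<close>.
\<close>

section \<open>The Minkowski function of a closed bounded convex body\<close>

lemma bdd_below_nonneg_reals: "bdd_below {t::real. 0 \<le> t \<and> P t}"
  by (rule bdd_belowI[of _ 0]) auto

lemma strictly_convex_midpoint_interior:
  assumes "strictly_convex C" "x \<in> C" "y \<in> C" "x \<noteq> y"
  shows "midpoint x y \<in> interior C"
proof -
  have "\<forall>t\<in>{0<..<1}. t *\<^sub>R x + (1 - t) *\<^sub>R y \<in> interior C"
    using assms unfolding strictly_convex_def by blast
  from bspec[OF this, of "1/2"] show ?thesis
    by (simp add: midpoint_def scaleR_add_right)
qed

context
  fixes F :: "'a::real_normed_vector set"
  assumes closed_F: "closed F" and bounded_F: "bounded F" and convex_F: "convex F"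
    and zero_interior_F: "0 \<in> interior F"
begin

lemma zero_in_F: "0 \<in> F"
  using zero_interior_F interior_subset by blast

lemma scale_image_mono:
  assumes "0 \<le> s" "s \<le> t" "x \<in> (\<lambda>f. s *\<^sub>R f) ` F"
  shows "x \<in> (\<lambda>f. t *\<^sub>R f) ` F"
proof (cases "t = 0")
  case True
  then show ?thesis using assms by simp
next
  case False
  then have t: "t > 0" using assms by simp
  obtain f where f: "f \<in> F" "x = s *\<^sub>R f" using assms by blast
  have "(1 - s/t) *\<^sub>R 0 + (s/t) *\<^sub>R f \<in> F"
    using convexD[OF convex_F zero_in_F f(1), of "1 - s/t" "s/t"] t assms by simp
  moreover have "x = t *\<^sub>R ((s/t) *\<^sub>R f)" using f t by simp
  ultimately show ?thesis by (metis add_0 image_eqI scaleR_zero_right)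
qed

lemma bounded_subset_scale_image:
  assumes "bounded Q"
  obtains t where "0 < t" "Q \<subseteq> (\<lambda>f. t *\<^sub>R f) ` F"
proof -
  obtain e where e: "e > 0" "cball 0 e \<subseteq> F"
    using zero_interior_F mem_interior_cball by blast
  obtain B where B: "B > 0" "\<And>q. q \<in> Q \<Longrightarrow> norm q \<le> B"
    using assms bounded_pos by blast
  have "q \<in> (\<lambda>f. (B/e) *\<^sub>R f) ` F" if "q \<in> Q" for q
  proof
    show "q = (B/e) *\<^sub>R ((e/B) *\<^sub>R q)" using e B by simp
    have "norm ((e/B) *\<^sub>R q) \<le> e"
      using B(2)[OF that] B(1) e(1) by (simp add: field_simps)
    then show "(e/B) *\<^sub>R q \<in> F" using e by auto
  qed
  then show ?thesis using that[of "B/e"] e B by auto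
qed

lemma minkowski_le: "0 \<le> t \<Longrightarrow> x \<in> (\<lambda>f. t *\<^sub>R f) ` F \<Longrightarrow> minkowski F x \<le> t"
  unfolding minkowski_def by (rule cInf_lower[OF _ bdd_below_nonneg_reals]) auto

lemma minkowski_set_nonempty: "{t. 0 \<le> t \<and> x \<in> (\<lambda>f. t *\<^sub>R f) ` F} \<noteq> {}"
proof -
  obtain t where "0 < t" "{x} \<subseteq> (\<lambda>f. t *\<^sub>R f) ` F"
    using bounded_subset_scale_image[of "{x}"] by auto
  then show ?thesis by (auto intro!: exI[of _ t])
qed

lemma minkowski_nonneg: "0 \<le> minkowski F x"
  unfolding minkowski_def by (rule cInf_greatest[OF minkowski_set_nonempty]) auto

lemma minkowski_less_imp_mem:
  assumes "minkowski F x < t"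
  shows "x \<in> (\<lambda>f. t *\<^sub>R f) ` F"
proof -
  obtain s where "0 \<le> s" "x \<in> (\<lambda>f. s *\<^sub>R f) ` F" "s < t"
    using cInf_lessD[OF minkowski_set_nonempty assms[unfolded minkowski_def]] by auto
  then show ?thesis using scale_image_mono by simp
qed

text \<open>The norm is dominated by a multiple of the Minkowski function because \<open>F\<close> is bounded.\<close>

lemma minkowski_eq_0_imp:
  assumes "minkowski F x = 0"
  shows "x = 0"
proof -
  obtain B where B: "B > 0" "\<And>f. f \<in> F \<Longrightarrow> norm f \<le> B"
    using bounded_F bounded_pos by blast
  have "norm x \<le> e" if e: "e > 0" for e
  proof -
    obtain f where f: "f \<in> F" "x = (e/B) *\<^sub>R f"
      using minkowski_less_imp_mem[of x "e/B"] assms e B(1) by auto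
    have "norm x = (e/B) * norm f" using f e B(1) by simp
    also have "\<dots> \<le> (e/B) * B" using B(2)[OF f(1)] e B(1) by (intro mult_left_mono) auto
    finally show ?thesis using B(1) by simp
  qed
  from this[of "norm x / 2"] show ?thesis by (cases "x = 0") auto
qed

text \<open>The infimum in the Minkowski function is attained: for \<open>t > 0\<close> because \<open>F\<close> is closed and
  contains the points \<open>x / s\<close> for \<open>s > t\<close>, and for \<open>t = 0\<close> because \<open>F\<close> is bounded.\<close>

lemma minkowski_le_imp_mem:
  assumes "minkowski F x \<le> t"
  shows "x \<in> (\<lambda>f. t *\<^sub>R f) ` F"
proof (cases "t = 0")
  case True
  then have "x = 0" using assms minkowski_nonneg[of x] minkowski_eq_0_imp by simp
  then show ?thesis using True zero_in_F by (auto intro!: image_eqI[of _ _ 0])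
next
  case False
  then have t: "t > 0" using assms minkowski_nonneg[of x] by linarith
  have "inverse (t + inverse (real (Suc n))) *\<^sub>R x \<in> F" for n
  proof -
    have pos: "t + inverse (real (Suc n)) > 0" using t by (simp add: add_pos_pos)
    have "minkowski F x < t + inverse (real (Suc n))" by (intro order.strict_trans1[OF assms]) simp
    then obtain f where "f \<in> F" "x = (t + inverse (real (Suc n))) *\<^sub>R f"
      using minkowski_less_imp_mem by blast
    then show ?thesis using pos by simp
  qed
  moreover have "(\<lambda>n. inverse (t + inverse (real (Suc n))) *\<^sub>R x) \<longlonglongrightarrow> inverse (t + 0) *\<^sub>R x"
    using t by (intro tendsto_intros LIMSEQ_inverse_real_of_nat) simp
  ultimately have "inverse (t + 0) *\<^sub>R x \<in> F"
    by (rule closed_sequentially[OF closed_F])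
  then show ?thesis using t by (intro image_eqI[of _ _ "inverse t *\<^sub>R x"]) auto
qed

text \<open>A point of the interior of \<open>F\<close> can be pushed slightly away from the origin inside \<open>F\<close>.\<close>

lemma minkowski_scale_interior_less:
  assumes "f \<in> interior F" "0 < t"
  shows "minkowski F (t *\<^sub>R f) < t"
proof -
  have "((\<lambda>s. (1 + s) *\<^sub>R f) \<longlongrightarrow> (1 + 0) *\<^sub>R f) (at_right 0)"
    by (intro tendsto_intros)
  then have "\<forall>\<^sub>F s in at_right 0. (1 + s) *\<^sub>R f \<in> interior F"
    using assms(1) by (intro topological_tendstoD) auto
  then have "\<forall>\<^sub>F s in at_right (0::real). (1 + s) *\<^sub>R f \<in> F \<and> 0 < s"
    using eventually_at_right_less[of "0::real"]
    by eventually_elim (use interior_subset in auto)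
  then obtain s :: real where s: "(1 + s) *\<^sub>R f \<in> F" "0 < s"
    using eventually_happens trivial_limit_at_right_real by blast
  have "t *\<^sub>R f = (t / (1 + s)) *\<^sub>R ((1 + s) *\<^sub>R f)" using s(2) by simp
  then have "minkowski F (t *\<^sub>R f) \<le> t / (1 + s)"
    using s assms(2) by (intro minkowski_le image_eqI[OF _ s(1)]) auto
  also have "\<dots> < t" using s(2) assms(2) by (simp add: field_simps)
  finally show ?thesis .
qed

lemma minkowski_midpoint_less:
  assumes "strictly_convex F" "0 < r" "a \<noteq> b" "minkowski F a \<le> r" "minkowski F b \<le> r"
  shows "minkowski F (midpoint a b) < r"
proof -
  obtain f g where fg: "f \<in> F" "a = r *\<^sub>R f" "g \<in> F" "b = r *\<^sub>R g"
    using assms(4,5) minkowski_le_imp_mem by blast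
  have "midpoint f g \<in> interior F"
    using strictly_convex_midpoint_interior[OF assms(1)] fg assms(3) by auto
  from minkowski_scale_interior_less[OF this assms(2)]
  show ?thesis by (simp add: fg midpoint_def scaleR_add_right scaleR_left_commute)
qed

section \<open>Maximal and minimal time functions at a midpoint\<close>

lemma translate_scale_image_iff:
  "q \<in> (\<lambda>f. x + t *\<^sub>R f) ` F \<longleftrightarrow> q - x \<in> (\<lambda>f. t *\<^sub>R f) ` F" for t :: real
  by (simp only: image_iff diff_eq_eq add.commute[of x])

lemma minkowski_le_max_time:
  assumes "bounded Q" "q \<in> Q"
  shows "minkowski F (q - x) \<le> max_time F x Q"
  unfolding max_time_def
proof (rule cInf_greatest)
  have "bounded ((\<lambda>p. p - x) ` Q)" using assms(1) by (rule bounded_translation_minus)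
  then obtain t where "0 < t" "(\<lambda>p. p - x) ` Q \<subseteq> (\<lambda>f. t *\<^sub>R f) ` F"
    using bounded_subset_scale_image by blast
  then have "t \<in> {t. 0 \<le> t \<and> Q \<subseteq> (\<lambda>f. x + t *\<^sub>R f) ` F}"
    using translate_scale_image_iff by auto
  then show "{t. 0 \<le> t \<and> Q \<subseteq> (\<lambda>f. x + t *\<^sub>R f) ` F} \<noteq> {}" by blast
next
  fix t assume "t \<in> {t. 0 \<le> t \<and> Q \<subseteq> (\<lambda>f. x + t *\<^sub>R f) ` F}"
  then show "minkowski F (q - x) \<le> t"
    using assms(2) translate_scale_image_iff minkowski_le by blast
qed

lemma min_time_le_minkowski:
  assumes "q \<in> Q"
  shows "min_time F x Q \<le> minkowski F (q - x)"
  unfolding min_time_def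
proof (rule cInf_lower[OF _ bdd_below_nonneg_reals])
  have "q \<in> (\<lambda>f. x + minkowski F (q - x) *\<^sub>R f) ` F"
    using minkowski_le_imp_mem translate_scale_image_iff by blast
  then show "minkowski F (q - x) \<in> {t. 0 \<le> t \<and> (\<lambda>f. x + t *\<^sub>R f) ` F \<inter> Q \<noteq> {}}"
    using assms minkowski_nonneg by blast
qed

lemma max_time_eq_0_imp:
  assumes "bounded Q" "q \<in> Q" "max_time F x Q \<le> 0"
  shows "q = x"
proof -
  have "minkowski F (q - x) = 0"
    using minkowski_le_max_time[OF assms(1,2), of x] assms(3) minkowski_nonneg[of "q - x"] by simp
  then show ?thesis using minkowski_eq_0_imp[of "q - x"] by simp
qed

lemma min_time_nonneg:
  assumes "nearest_proj F x Q \<noteq> {}"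
  shows "0 \<le> min_time F x Q"
proof -
  obtain u where "minkowski F (u - x) = min_time F x Q"
    using assms unfolding nearest_proj_def by blast
  then show ?thesis using minkowski_nonneg[of "u - x"] by simp
qed

lemma min_time_eq_0_iff:
  assumes "nearest_proj F x Q \<noteq> {}"
  shows "min_time F x Q = 0 \<longleftrightarrow> x \<in> Q"
proof
  assume "min_time F x Q = 0"
  then obtain u where "u \<in> Q" "minkowski F (u - x) = 0"
    using assms unfolding nearest_proj_def by auto
  then show "x \<in> Q" using minkowski_eq_0_imp[of "u - x"] by simp
next
  assume "x \<in> Q"
  then have "min_time F x Q \<le> minkowski F 0" using min_time_le_minkowski[of x Q x] by simp
  moreover have "minkowski F 0 \<le> 0" using zero_in_F by (intro minkowski_le) auto
  ultimately show "min_time F x Q = 0" using min_time_nonneg[OF assms] by linarith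
qed

lemma max_time_midpoint_less:
  assumes "strictly_convex F" "bounded Q" "0 < r" "x \<noteq> y"
    and "max_time F x Q \<le> r" "max_time F y Q \<le> r"
    and "farthest_proj F (midpoint x y) Q \<noteq> {}"
  shows "max_time F (midpoint x y) Q < r"
proof -
  obtain w where w: "w \<in> Q" "minkowski F (w - midpoint x y) = max_time F (midpoint x y) Q"
    using assms(7) unfolding farthest_proj_def by blast
  have "minkowski F (midpoint (w - x) (w - y)) < r"
    using assms(3-6) minkowski_le_max_time[OF assms(2) w(1)]
    by (intro minkowski_midpoint_less[OF assms(1)]) (auto intro: order_trans)
  moreover have "midpoint (w - x) (w - y) = w - midpoint x y"
    by (simp add: midpoint_def algebra_simps flip: scaleR_add_left)
  ultimately show ?thesis using w by simp
qed

text \<open>Nearest points to \<open>x\<close> and \<open>y\<close> provide displacements of size at most \<open>r\<close>; at the midpoint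
  any point of \<open>Q\<close> gives an upper bound. If the two displacements differ, the strict gain comes
  from the roundness of \<open>F\<close>, otherwise from that of \<open>Q\<close>.\<close>

lemma min_time_midpoint_less:
  assumes "strictly_convex F" "strictly_convex Q" "0 < r" "x \<noteq> y"
    and "min_time F x Q \<le> r" "min_time F y Q \<le> r"
    and "nearest_proj F x Q \<noteq> {}" "nearest_proj F y Q \<noteq> {}"
  shows "min_time F (midpoint x y) Q < r"
proof -
  obtain u where u: "u \<in> Q" "minkowski F (u - x) \<le> r"
    using assms(5,7) unfolding nearest_proj_def by auto
  obtain v where v: "v \<in> Q" "minkowski F (v - y) \<le> r"
    using assms(6,8) unfolding nearest_proj_def by auto
  have diff: "midpoint u v - midpoint x y = midpoint (u - x) (v - y)"
    by (simp add: midpoint_def algebra_simps)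
  show ?thesis
  proof (cases "u - x = v - y")
    case False
    have "midpoint u v \<in> Q"
    proof (cases "u = v")
      case True
      then show ?thesis using u by simp
    next
      case False
      then show ?thesis
        using strictly_convex_midpoint_interior[OF assms(2) u(1) v(1)] interior_subset by blast
    qed
    then have "min_time F (midpoint x y) Q \<le> minkowski F (midpoint (u - x) (v - y))"
      using min_time_le_minkowski diff by metis
    then show ?thesis
      using minkowski_midpoint_less[OF assms(1,3) False u(2) v(2)] by linarith
  next
    case True
    \<comment> \<open>The common displacement \<open>w\<close> also leads from the midpoint of \<open>x\<close> and \<open>y\<close> to that of \<open>u\<close>
      and \<open>v\<close>.\<close>
    define w where "w = u - x"
    have "u \<noteq> v" using True assms(4) by auto
    then have mid: "midpoint u v \<in> interior Q"
      using strictly_convex_midpoint_interior[OF assms(2) u(1) v(1)] by blast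
    have "((\<lambda>s. midpoint u v - s *\<^sub>R w) \<longlongrightarrow> midpoint u v - 0 *\<^sub>R w) (at_right 0)"
      by (intro tendsto_intros)
    then have "\<forall>\<^sub>F s in at_right 0. midpoint u v - s *\<^sub>R w \<in> interior Q"
      using mid by (intro topological_tendstoD) auto
    then have "\<forall>\<^sub>F s in at_right (0::real). midpoint u v - s *\<^sub>R w \<in> Q \<and> 0 < s \<and> s < 1"
      using eventually_at_right_real[of 0 "1::real", OF zero_less_one]
      by eventually_elim (use interior_subset in auto)
    then obtain s :: real where s: "midpoint u v - s *\<^sub>R w \<in> Q" "0 < s" "s < 1"
      using eventually_happens trivial_limit_at_right_real by blast
    have "midpoint u v - midpoint x y = w"
      using diff by (simp add: w_def flip: True)
    then have "midpoint u v - s *\<^sub>R w - midpoint x y = (1 - s) *\<^sub>R w"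
      by (simp add: algebra_simps)
    then have "min_time F (midpoint x y) Q \<le> minkowski F ((1 - s) *\<^sub>R w)"
      using min_time_le_minkowski[OF s(1), of "midpoint x y"] by simp
    also have "\<dots> \<le> (1 - s) * r"
    proof (rule minkowski_le)
      obtain f where "f \<in> F" "w = r *\<^sub>R f"
        using minkowski_le_imp_mem[OF u(2)] w_def by blast
      then show "(1 - s) *\<^sub>R w \<in> (\<lambda>f. ((1 - s) * r) *\<^sub>R f) ` F" by auto
    qed (use s assms(3) in simp)
    also have "\<dots> < r" using s assms(3) by (simp add: algebra_simps)
    finally show ?thesis .
  qed
qed

end

section \<open>Uniqueness of optimal solutions\<close>

lemma cost_le_iff:
  assumes "finite I" "finite J" "I \<noteq> {} \<or> J \<noteq> {}"
  shows "cost F I \<Omega> J \<Theta> x \<le> r \<longleftrightarrow>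
    (\<forall>i\<in>I. max_time F x (\<Omega> i) \<le> r) \<and> (\<forall>j\<in>J. min_time F x (\<Theta> j) \<le> r)"
  unfolding cost_def using assms by (subst Max_le_iff) auto

lemma cost_less_iff:
  assumes "finite I" "finite J" "I \<noteq> {} \<or> J \<noteq> {}"
  shows "cost F I \<Omega> J \<Theta> x < r \<longleftrightarrow>
    (\<forall>i\<in>I. max_time F x (\<Omega> i) < r) \<and> (\<forall>j\<in>J. min_time F x (\<Theta> j) < r)"
  unfolding cost_def using assms by (subst Max_less_iff) auto

theorem theorem3p5:
  fixes F S :: "'a::real_normed_vector set"
    and I :: "'i set" and \<Omega> :: "'i \<Rightarrow> 'a set"
    and J :: "'j set" and \<Theta> :: "'j \<Rightarrow> 'a set"
  assumes "closed F" and "bounded F" and "convex F" and "0 \<in> interior F"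
    and "finite I" and "finite J" and "I \<noteq> {} \<or> J \<noteq> {}"
    and "\<And>i. i \<in> I \<Longrightarrow> \<Omega> i \<noteq> {} \<and> closed (\<Omega> i) \<and> bounded (\<Omega> i)"
    and "\<And>j. j \<in> J \<Longrightarrow> \<Theta> j \<noteq> {} \<and> closed (\<Theta> j)"
    and "S \<noteq> {}" and "closed S"
    and "strictly_convex F"
    and "\<And>j. j \<in> J \<Longrightarrow> strictly_convex (\<Theta> j)"
    and "convex S"
    and "\<And>x i. x \<in> S \<Longrightarrow> i \<in> I \<Longrightarrow> farthest_proj F x (\<Omega> i) \<noteq> {}"
    and "\<And>x j. x \<in> S \<Longrightarrow> j \<in> J \<Longrightarrow> nearest_proj F x (\<Theta> j) \<noteq> {}"
  shows "(\<exists>\<^sub>\<le>\<^sub>1x. is_arg_min (cost F I \<Omega> J \<Theta>) (\<lambda>x. x \<in> S) x) \<longleftrightarrow>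
    (I = {} \<and> (\<exists>\<^sub>\<le>\<^sub>1x. x \<in> (\<Inter>j\<in>J. \<Theta> j \<inter> S))) \<or> I \<noteq> {}"
proof -
  let ?G = "cost F I \<Omega> J \<Theta>"
  let ?opt = "is_arg_min ?G (\<lambda>x. x \<in> S)"
  note F = assms(1-4)
  note le = cost_le_iff[OF assms(5-7), of F \<Omega> \<Theta>]
  note less = cost_less_iff[OF assms(5-7), of F \<Omega> \<Theta>]
  have two_optima_value: "?G x \<le> 0" if "?opt x" "?opt y" "x \<noteq> y" for x y
  proof (rule ccontr)
    assume "\<not> ?G x \<le> 0"
    then have pos: "0 < ?G x" by simp
    have x: "x \<in> S" and y: "y \<in> S" and eq: "?G y \<le> ?G x"
      using that unfolding is_arg_min_def by (auto simp: not_less)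
    have mid: "midpoint x y \<in> S"
      using assms(14) x y by (metis convex_contains_segment midpoint_in_closed_segment subsetD)
    have "?G (midpoint x y) < ?G x"
      unfolding less
    proof (intro conjI ballI)
      fix i assume "i \<in> I"
      then show "max_time F (midpoint x y) (\<Omega> i) < ?G x"
        using le[of x "?G x"] le[of y "?G x"] eq assms(8,15) mid
        by (intro max_time_midpoint_less[OF F assms(12) _ pos that(3)]) auto
    next
      fix j assume "j \<in> J"
      then show "min_time F (midpoint x y) (\<Theta> j) < ?G x"
        using le[of x "?G x"] le[of y "?G x"] eq assms(13,16) x y
        by (intro min_time_midpoint_less[OF F assms(12) _ pos that(3)]) auto
    qed
    then show False using that(1) mid unfolding is_arg_min_def by blast
  qed
  have "?thesis" if ne: "I \<noteq> {}"
  proof -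
    have "x = y" if opt: "?opt x" "?opt y" for x y
    proof (rule ccontr)
      assume "x \<noteq> y"
      then have "?G x \<le> 0" "?G y \<le> 0" using two_optima_value opt by metis+
      moreover obtain i where i: "i \<in> I" using ne by blast
      moreover obtain q where "q \<in> \<Omega> i" using assms(8)[OF i] by blast
      ultimately have "q = x" "q = y"
        using max_time_eq_0_imp[OF F] assms(8)[OF i] le by blast+
      then show False using \<open>x \<noteq> y\<close> by simp
    qed
    then show ?thesis using ne unfolding Uniq_def by blast
  qed
  moreover have "?thesis" if empty: "I = {}"
  proof -
    have J: "J \<noteq> {}" using assms(7) empty by blast
    have nonneg: "0 \<le> ?G x" if "x \<in> S" for x
    proof -
      obtain j where "j \<in> J" using J by blast
      then show ?thesis
        using le[of x "?G x"] min_time_nonneg[OF F assms(16)[OF that]] by force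
    qed
    have zero: "?G x \<le> 0 \<longleftrightarrow> x \<in> (\<Inter>j\<in>J. \<Theta> j \<inter> S)" if "x \<in> S" for x
    proof -
      have "min_time F x (\<Theta> j) \<le> 0 \<longleftrightarrow> x \<in> \<Theta> j" if "j \<in> J" for j
        using min_time_eq_0_iff[OF F] min_time_nonneg[OF F] assms(16)[OF \<open>x \<in> S\<close> that]
        by (metis order_antisym order_refl)
      then show ?thesis using le that empty by auto
    qed
    have common_point_optimal: "?opt x" if "x \<in> (\<Inter>j\<in>J. \<Theta> j \<inter> S)" for x
    proof -
      have "x \<in> S" using that J by blast
      moreover from this have "?G x \<le> 0" using zero that by blast
      ultimately show ?thesis using nonneg unfolding is_arg_min_def by force
    qed
    have "x = y" if "\<exists>\<^sub>\<le>\<^sub>1x. x \<in> (\<Inter>j\<in>J. \<Theta> j \<inter> S)" "?opt x" "?opt y" for x y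
    proof (rule ccontr)
      assume "x \<noteq> y"
      then have "?G x \<le> 0" "?G y \<le> 0" using two_optima_value that by metis+
      moreover have "x \<in> S" "y \<in> S" using that unfolding is_arg_min_def by auto
      ultimately show False using zero that(1) \<open>x \<noteq> y\<close> unfolding Uniq_def by blast
    qed
    then show ?thesis using empty common_point_optimal unfolding Uniq_def by blast
  qed
  ultimately show ?thesis by blast
qed

end
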